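(* Let $D\subset\mathbb R^d$ be a bounded domain (bounded open set) that satisfies the inner cone condition with parameters $\bar r>0$ and $\theta\in(0,\pi)$. Then one has $$K_n\le C_D\,n^2,\qquad n\ge1,$$ where $C_D$ depends on $d$, $|D|$, $\bar r$ and $\theta$ (and not on $n$). Here $n$ ranges over the values $n=\binom{d+\ell}{\ell}$, $\ell\ge0$, and $K_n$ is associated to the space $V_n=\mathbb P_\ell$ of polynomials of total degree at most $\ell$.
   Context: $|\cdot|$ denotes Lebesgue measure of sets. $D$ is equipped with the uniform probability measure $\mu=|D|^{-1}\chi_D\,dx$ and $L^2(D)=L^2(D,\mu)$. $\mathbb P_\ell$ is the space of real polynomials in $d$ variables of total degree at most $\ell$, of dimension $n=\binom{d+\ell}{\ell}$; $V_n=\mathbb P_\ell$. Define $k_n(x)=\max_{v\in V_n\setminus\{0\}}\frac{|v(x)|^2}{\|v\|_{L^2(D)}^2}$ and $K_n=\sup_{x\in D}k_n(x)$. Inner cone condition: an open set $D\subset\mathbb R^d$ satisfies the inner cone condition if there exist $\bar r>0$ and $\theta\in(0,\pi)$ such that for all $x\in\overline D$ there exists a unit vector $u$ such that the cone $C_{\bar r,\theta}(x,u):=\{x+r\,v:\ 0\le r\le\bar r,\ |v|=1,\ u\cdot v\ge\cos(\theta)\}$ is contained in $\overline D$.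
   Formalization: The formal theorem additionally assumes that the boundary of D has Lebesgue measure zero (and D is nonempty); without this the claim fails, since the cones lie only in the closure of D, e.g. an interval plus a dense open set of tiny measure. *)

theory Defs
  imports "HOL-Analysis.Analysis"
begin

text \<open>Polynomials are represented by the functions they induce on \<open>real ^ 'd\<close>; the index set of
  the sum is finite, its elements being the multi-indices of length at most \<open>l\<close>.\<close>

definition polys_deg_le :: "nat \<Rightarrow> ((real ^ 'd) \<Rightarrow> real) set" where
  "polys_deg_le l = {v. \<exists>c :: ('d \<Rightarrow> nat) \<Rightarrow> real.
     v = (\<lambda>x. \<Sum>a | (\<Sum>i\<in>UNIV. a i) \<le> l. c a * (\<Prod>i\<in>UNIV. (x $ i) ^ a i))}"

definition L2_norm_on :: "(real ^ 'd) set \<Rightarrow> ((real ^ 'd) \<Rightarrow> real) \<Rightarrow> real" where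
  "L2_norm_on D v = sqrt (\<integral>x. \<bar>v x\<bar>\<^sup>2 \<partial>(uniform_measure lborel D))"

text \<open>Both suprema are taken in \<open>ereal\<close>, so that a finite upper bound on them is never an
  artefact of an unbounded supremum. For a finite-dimensional space of continuous functions on
  which \<open>L2_norm_on D\<close> is a norm, the supremum in \<open>christoffel\<close> is attained, i.e. it is a
  maximum.\<close>

definition christoffel ::
    "((real ^ 'd) \<Rightarrow> real) set \<Rightarrow> (real ^ 'd) set \<Rightarrow> real ^ 'd \<Rightarrow> ereal" where
  "christoffel V D x = (SUP v \<in> V - {\<lambda>_. 0}. ereal (\<bar>v x\<bar>\<^sup>2 / (L2_norm_on D v)\<^sup>2))"

definition christoffel_sup ::
    "((real ^ 'd) \<Rightarrow> real) set \<Rightarrow> (real ^ 'd) set \<Rightarrow> ereal" where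
  "christoffel_sup V D = (SUP x \<in> D. christoffel V D x)"

definition trunc_cone :: "real \<Rightarrow> real \<Rightarrow> real ^ 'd \<Rightarrow> real ^ 'd \<Rightarrow> (real ^ 'd) set" where
  "trunc_cone r \<theta> x u =
     {x + t *\<^sub>R v | t v. 0 \<le> t \<and> t \<le> r \<and> norm v = 1 \<and> u \<bullet> v \<ge> cos \<theta>}"

text \<open>The cones lie in the closure of \<open>D\<close>, while norms are taken over \<open>D\<close>. The condition does not
  prevent the frontier of \<open>D\<close> from having positive measure (e.g. a dense open subset of \<open>(0,1)\<close>
  satisfies it), so results comparing the two need the frontier to be negligible.\<close>

definition inner_cone_condition :: "real \<Rightarrow> real \<Rightarrow> (real ^ 'd) set \<Rightarrow> bool" where
  "inner_cone_condition r \<theta> D \<longleftrightarrow>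
     0 < r \<and> 0 < \<theta> \<and> \<theta> < pi \<and>
     (\<forall>x \<in> closure D. \<exists>u. norm u = 1 \<and> trunc_cone r \<theta> x u \<subseteq> closure D)"

end

theory Submission
  imports Defs "HOL-Computational_Algebra.Polynomial"
begin

text \<open>
  The claim is a bound on point values: for a polynomial \<open>v\<close> of total degree at most \<open>l\<close> and
  \<open>x \<in> D\<close>, the value \<open>|v x|^2\<close> must be at most a constant times \<open>n^2\<close> times the integral of
  \<open>|v|^2\<close> over a cone with vertex \<open>x\<close>. With \<open>d\<close> the dimension, the factor \<open>n^2\<close> is exactly what a
  one-dimensional problem yields. A univariate polynomial \<open>p\<close> of degree at most \<open>l\<close> satisfies
  \<open>|p 0|^2 \<le> d n^2 \<integral> t^(d-1) |p t|^2 dt\<close>, with the integral over \<open>[0,1]\<close> and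
  \<open>n = (d + l) choose l\<close> (\<open>poly_0_sq_le_weighted_integral\<close>). Indeed, \<open>p 0\<close> is the inner product of
  \<open>p\<close> with a polynomial \<open>q\<close> that can be written down by partial fractions
  (\<open>polynomial_reproducing_at_0\<close>), and \<open>q 0 = d n^2\<close> is the constant in the Cauchy-Schwarz
  inequality.

  The weight \<open>t^(d-1)\<close> is the one that appears in polar coordinates about \<open>x\<close>. The
  one-dimensional bound holds for \<open>t \<mapsto> v (x + t y)\<close> for every \<open>y\<close>. Let \<open>y\<close> vary over a ball \<open>B\<close>
  about a point of the axis of the cone (moved to the origin), chosen so small that the
  segments from the vertex to \<open>B\<close> stay in the cone (\<open>scaled_cball_in_trunc_cone\<close>). Integrating
  over \<open>B\<close>, the left-hand side becomes \<open>|B| |v x|^2\<close>, and by Tonelli's theorem and the scaling of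
  Lebesgue measure the right-hand side is at most \<open>2 d n^2\<close> times the integral of \<open>|v|^2\<close> over
  the cone (\<open>nn_integral_rays_le\<close>). The volume of \<open>B\<close> depends only on \<open>d\<close>, \<open>r\<close> and \<open>\<theta>\<close>. The cone
  lies in the closure of \<open>D\<close>, which has the same integrals as \<open>D\<close> since the frontier is a null
  set; normalising the measure on \<open>D\<close> contributes the factor \<open>|D|\<close>. Altogether
  \<open>C = 2 d |D| / |B|\<close>.
\<close>

section \<open>Alternating binomial sums\<close>

text \<open>The sum is, up to sign, an \<open>l\<close>-th finite difference, and such a difference annihilates
  every polynomial in \<open>k\<close> of degree less than \<open>l\<close>. The induction removes one linear factor
  \<open>k + a m\<close>: the part with \<open>a m\<close> keeps \<open>l\<close>, and the part with \<open>k\<close> is absorbed by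
  \<open>k * (l choose k) = l * ((l - 1) choose (k - 1))\<close>, which lowers \<open>l\<close> by one and shifts the
  remaining factors.\<close>

lemma alternating_choose_prod_eq_0:
  fixes a :: "nat \<Rightarrow> real"
  assumes "m < l"
  shows "(\<Sum>k\<le>l. (-1)^k * real (l choose k) * (\<Prod>j<m. real k + a j)) = 0"
  using assms
proof (induction m arbitrary: l a)
  case 0
  then show ?case using choose_alternating_sum[of l, where 'a=real] by simp
next
  case (Suc m)
  obtain l' where l: "l = Suc l'" and "m < l'"
    using Suc.prems by (cases l) auto
  define Q where "Q k = (\<Prod>j<m. real k + a j)" for k
  have "(\<Sum>k\<le>l. (-1)^k * real (l choose k) * (real k * Q k))
      = (\<Sum>k\<le>l'. (-1)^Suc k * (real (Suc k) * real (l choose Suc k)) * Q (Suc k))"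
    unfolding l by (subst sum.atMost_Suc_shift) (simp add: mult_ac)
  also have "\<dots> = (\<Sum>k\<le>l'. - real l * ((-1)^k * real (l' choose k) * (\<Prod>j<m. real k + (1 + a j))))"
    unfolding l of_nat_mult[symmetric] Suc_times_binomial
    by (intro sum.cong refl) (simp add: Q_def algebra_simps)
  also have "\<dots> = 0"
    unfolding sum_distrib_left[symmetric] using Suc.IH[OF \<open>m < l'\<close>, of "\<lambda>j. 1 + a j"] by simp
  finally have "(\<Sum>k\<le>l. (-1)^k * real (l choose k) * (real k * Q k)) = 0" .
  moreover have "(\<Sum>k\<le>l. (-1)^k * real (l choose k) * (a m * Q k)) = 0"
  proof -
    have "(\<Sum>k\<le>l. (-1)^k * real (l choose k) * (a m * Q k))
        = a m * (\<Sum>k\<le>l. (-1)^k * real (l choose k) * Q k)"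
      by (simp add: sum_distrib_left mult_ac)
    then show ?thesis using Suc.IH[of l a] Suc.prems by (simp add: Q_def)
  qed
  moreover have "(\<Sum>k\<le>l. (-1)^k * real (l choose k) * (\<Prod>j<Suc m. real k + a j))
     = (\<Sum>k\<le>l. (-1)^k * real (l choose k) * (real k * Q k))
       + (\<Sum>k\<le>l. (-1)^k * real (l choose k) * (a m * Q k))"
    unfolding sum.distrib[symmetric] Q_def by (simp add: algebra_simps)
  ultimately show ?case by simp
qed

text \<open>Modulo \<open>k + y\<close> the product is congruent to \<open>\<Prod>j<m. a j\<close>, and the quotient is a polynomial in
  \<open>k\<close> of degree less than \<open>l\<close>, which the alternating sum does not see.\<close>

lemma alternating_choose_partial_fraction:
  fixes a :: "nat \<Rightarrow> real"
  assumes "m \<le> l" "0 < y"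
  shows "(\<Sum>k\<le>l. (-1)^k * real (l choose k) * (\<Prod>j<m. real k + y + a j) / (real k + y))
       = (\<Prod>j<m. a j) * (\<Sum>k\<le>l. (-1)^k * real (l choose k) / (real k + y))"
  using assms(1)
proof (induction m)
  case 0
  then show ?case by simp
next
  case (Suc m)
  let ?P = "\<lambda>k. \<Prod>j<m. real k + y + a j"
  have split: "(-1)^k * real (l choose k) * (\<Prod>j<Suc m. real k + y + a j) / (real k + y)
       = (-1)^k * real (l choose k) * ?P k
         + a m * ((-1)^k * real (l choose k) * ?P k / (real k + y))" for k
  proof -
    have "real k + y \<noteq> 0" using \<open>0 < y\<close> by (simp add: add_nonneg_eq_0_iff)
    then show ?thesis by (simp add: field_simps)
  qed
  have "(\<Sum>k\<le>l. (-1)^k * real (l choose k) * ?P k) = 0"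
    using alternating_choose_prod_eq_0[of m l "\<lambda>j. y + a j"] Suc.prems by (simp add: add.assoc)
  then show ?case
    unfolding split sum.distrib sum_distrib_left[symmetric] using Suc by simp
qed

text \<open>This is the Beta integral of \<open>(1 - t)^l * t powr (y - 1)\<close> over \<open>[0,1]\<close>, expanded by the
  binomial theorem. Pascal's rule gives the recursion \<open>T (l + 1) y = T l y - T l (y + 1)\<close>, which
  avoids the integral.\<close>

lemma alternating_choose_reciprocal_sum:
  fixes y :: real
  assumes "0 < y"
  shows "(\<Sum>k\<le>l. (-1)^k * real (l choose k) / (real k + y)) = fact l / pochhammer y (Suc l)"
  using assms
proof (induction l arbitrary: y)
  case 0
  then show ?case by simp
next
  case (Suc l)
  let ?T = "\<lambda>l y. \<Sum>k\<le>l. (-1)^k * real (l choose k) / (real k + y)"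
  have "?T l y = (\<Sum>k\<le>Suc l. (-1)^k * real (l choose k) / (real k + y))"
    by simp
  also have "\<dots> = 1 / y + (\<Sum>k\<le>l. (-1)^Suc k * real (l choose Suc k) / (real (Suc k) + y))"
    by (subst sum.atMost_Suc_shift) simp
  finally have T_l: "?T l y = 1 / y + (\<Sum>k\<le>l. (-1)^Suc k * real (l choose Suc k) / (real (Suc k) + y))" .
  have "?T (Suc l) y = 1 / y + (\<Sum>k\<le>l. (-1)^Suc k * real (Suc l choose Suc k) / (real (Suc k) + y))"
    by (subst sum.atMost_Suc_shift) simp
  also have "(\<Sum>k\<le>l. (-1)^Suc k * real (Suc l choose Suc k) / (real (Suc k) + y))
      = (\<Sum>k\<le>l. (-1)^Suc k * real (l choose Suc k) / (real (Suc k) + y)) - ?T l (y + 1)"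
    unfolding sum_subtractf[symmetric]
    by (intro sum.cong refl) (simp add: add_divide_distrib diff_divide_distrib ring_distribs add_ac)
  finally have "?T (Suc l) y = ?T l y - ?T l (y + 1)"
    using T_l by simp
  also have "\<dots> = fact l / pochhammer y (Suc l) - fact l / pochhammer (y + 1) (Suc l)"
    using Suc.IH[of y] Suc.IH[of "y + 1"] Suc.prems by simp
  also have "\<dots> = fact (Suc l) / pochhammer y (Suc (Suc l))"
  proof -
    let ?c = "pochhammer (y + 1) l"
    have nz: "?c > 0" "y + 1 + real l > 0" using Suc.prems by (auto intro!: pochhammer_pos)
    have eqs: "pochhammer y (Suc l) = y * ?c" "pochhammer (y + 1) (Suc l) = ?c * (y + 1 + real l)"
      "pochhammer y (Suc (Suc l)) = y * (?c * (y + 1 + real l))"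
      by (simp_all only: pochhammer_rec[of y] pochhammer_Suc[of "y + 1"])
    have frac: "f / (y * c) - f / (c * e) = (e - y) * f / (y * (c * e))"
      if "c > 0" "e > 0" for f c e :: real
      using that Suc.prems by (simp add: field_simps)
    have fact_eq: "(fact (Suc l) :: real) = (y + 1 + real l - y) * fact l"
      by simp
    show ?thesis
      unfolding eqs fact_eq by (rule frac[OF nz])
  qed
  finally show ?case .
qed

section \<open>Point evaluation of univariate polynomials at an endpoint\<close>

text \<open>The equations form a linear system with a Hilbert-type matrix, since
  \<open>1 / (k + d + j)\<close> is the integral of \<open>t^k * t^j * t^(d-1)\<close> over \<open>[0,1]\<close>. The solution comes from
  the partial fraction decomposition of the rational function of \<open>j\<close> with poles at
  \<open>-d, -d-1, ..., -d-l\<close>, zeros at \<open>1, ..., l\<close> and value 1 at 0; the \<open>c k\<close> are its residues.\<close>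

lemma reciprocal_moment_coeffs:
  assumes "0 < d"
  obtains c :: "nat \<Rightarrow> real" where
    "c 0 = real d * (real ((d + l) choose l))\<^sup>2"
    "\<And>j. j \<le> l \<Longrightarrow> (\<Sum>k\<le>l. c k / real (k + d + j)) = (if j = 0 then 1 else 0)"
proof -
  define Z :: real where "Z = fact l * (fact l / pochhammer (real d) (Suc l))"
  define c where "c k = (-1)^k * real (l choose k) * (\<Prod>i<l. real k + real d + (1 + real i)) / Z" for k
  have poch: "pochhammer (real d) (Suc l) > 0"
    using assms by (intro pochhammer_pos) simp
  then have Z: "Z > 0" by (simp add: Z_def)
  have sum_c: "(\<Sum>k\<le>l. c k / real (k + d + j)) = (if j = 0 then 1 else 0)" if "j \<le> l" for j
  proof -
    let ?y = "real (d + j)"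
    \<comment> \<open>Relative to the denominator \<open>k + d + j\<close>, the factors \<open>k + d + 1 + i\<close> have offsets
        \<open>1 + i - j\<close>, whose product vanishes exactly for \<open>1 \<le> j \<le> l\<close>.\<close>
    have "(\<Sum>k\<le>l. c k / real (k + d + j))
        = (\<Sum>k\<le>l. (-1)^k * real (l choose k)
             * (\<Prod>i<l. real k + ?y + (1 + real i - real j)) / (real k + ?y)) / Z"
      unfolding sum_divide_distrib c_def
      by (intro sum.cong refl) (simp add: add_ac)
    also have "\<dots> = (\<Prod>i<l. 1 + real i - real j)
        * (\<Sum>k\<le>l. (-1)^k * real (l choose k) / (real k + ?y)) / Z"
      using assms by (subst alternating_choose_partial_fraction) auto
    also have "\<dots> = (\<Prod>i<l. 1 + real i - real j) * (fact l / pochhammer ?y (Suc l)) / Z"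
      using assms by (subst alternating_choose_reciprocal_sum) auto
    also have "\<dots> = (if j = 0 then 1 else 0)"
    proof (cases "j = 0")
      case True
      have "(\<Prod>i<l. 1 + real i) = fact l"
        by (simp add: fact_prod_Suc atLeast0LessThan)
      then show ?thesis using True poch by (simp add: Z_def)
    next
      case False
      then have "(\<Prod>i<l. 1 + real i - real j) = 0"
        using \<open>j \<le> l\<close> by (intro prod_zero) (auto intro!: bexI[of _ "j - 1"])
      then show ?thesis using False by simp
    qed
    finally show ?thesis .
  qed
  have "real ((d + l) choose l) = pochhammer (real d + 1) l / fact l"
    using gbinomial_pochhammer'[of "real (d + l)" l] by (simp add: binomial_gbinomial)
  moreover have "(\<Prod>i<l. real d + (1 + real i)) = pochhammer (real d + 1) l"
    by (simp add: pochhammer_prod atLeast0LessThan add_ac)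
  moreover have "pochhammer (real d) (Suc l) = real d * pochhammer (real d + 1) l"
    by (rule pochhammer_rec)
  ultimately have "c 0 = real d * (real ((d + l) choose l))\<^sup>2"
    using Z by (simp add: c_def Z_def power2_eq_square)
  with sum_c that show thesis by blast
qed

text \<open>The polynomial \<open>q\<close> is the reproducing kernel at the endpoint 0 for the Jacobi weight
  \<open>t^(d-1)\<close>. By linearity it is enough to reproduce the monomials \<open>t^j\<close>, which is the system solved
  by the coefficients above.\<close>

lemma polynomial_reproducing_at_0:
  assumes "0 < d"
  obtains q :: "real poly" where
    "degree q \<le> l" "poly q 0 = real d * (real ((d + l) choose l))\<^sup>2"
    "\<And>p. degree p \<le> l \<Longrightarrow>
       ((\<lambda>t. t^(d-1) * (poly p t * poly q t)) has_integral poly p 0) {0..1}"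
proof -
  obtain c where c0: "c 0 = real d * (real ((d + l) choose l))\<^sup>2"
    and c: "\<And>j. j \<le> l \<Longrightarrow> (\<Sum>k\<le>l. c k / real (k + d + j)) = (if j = 0 then 1 else 0)"
    using reciprocal_moment_coeffs[OF assms] by metis
  define q where "q = (\<Sum>k\<le>l. monom (c k) k)"
  have poly_q: "poly q t = (\<Sum>k\<le>l. c k * t^k)" for t
    by (simp add: q_def poly_sum poly_monom)
  have pow: "((\<lambda>t::real. t^(k + d + j - 1)) has_integral 1 / real (k + d + j)) {0..1}" for k j
  proof -
    have "((\<lambda>t::real. t^(k + d + j - 1)) has_integral
        1^(k + d + j) / real (k + d + j) - 0^(k + d + j) / real (k + d + j)) {0..1}"
      using assms
      by (intro fundamental_theorem_of_calculus)
         (auto intro!: derivative_eq_intros simp: has_real_derivative_iff_has_vector_derivative[symmetric])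
    then show ?thesis using assms by (simp add: power_0_left)
  qed
  have "((\<lambda>t. t^(d-1) * (poly p t * poly q t)) has_integral poly p 0) {0..1}" if "degree p \<le> l" for p
  proof -
    have poly_p: "poly p t = (\<Sum>j\<le>l. coeff p j * t^j)" for t
      by (subst poly_as_sum_of_monoms'[OF that, symmetric]) (simp add: poly_sum poly_monom)
    have "((\<lambda>t. \<Sum>j\<le>l. coeff p j * (\<Sum>k\<le>l. c k * t^(k + d + j - 1)))
        has_integral (\<Sum>j\<le>l. coeff p j * (\<Sum>k\<le>l. c k * (1 / real (k + d + j))))) {0..1}"
      by (intro has_integral_sum has_integral_mult_right pow) auto
    moreover have "(\<Sum>j\<le>l. coeff p j * (\<Sum>k\<le>l. c k * (1 / real (k + d + j)))) = poly p 0"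
    proof -
      have "(\<Sum>j\<le>l. coeff p j * (\<Sum>k\<le>l. c k * (1 / real (k + d + j))))
          = (\<Sum>j\<le>l. coeff p j * (if j = 0 then 1 else 0))"
        using c by (intro sum.cong refl) simp
      also have "\<dots> = coeff p 0" by (simp add: if_distrib[of "(*) _"] sum.delta cong: if_cong)
      finally show ?thesis by (simp add: poly_0_coeff_0)
    qed
    moreover have "(\<Sum>j\<le>l. coeff p j * (\<Sum>k\<le>l. c k * t^(k + d + j - 1)))
        = t^(d-1) * (poly p t * poly q t)" for t
    proof -
      have "t^(k + d + j - 1) = t^(d-1) * (t^j * t^k)" for k j
        using assms by (simp add: power_add[symmetric] algebra_simps)
      then show ?thesis
        unfolding poly_p poly_q sum_product unfolding sum_distrib_left
        by (intro sum.cong refl) (simp add: mult_ac)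
    qed
    ultimately show ?thesis by simp
  qed
  moreover have "degree q \<le> l"
    unfolding q_def by (intro degree_sum_le) (auto intro: order_trans[OF degree_monom_le])
  moreover have "poly q 0 = real d * (real ((d + l) choose l))\<^sup>2"
    unfolding poly_q by (subst sum.atMost_shift) (simp add: c0)
  ultimately show thesis using that by blast
qed

text \<open>This is the Cauchy-Schwarz inequality for \<open>p(0) = \<langle>p, q\<rangle>\<close> with the reproducing polynomial \<open>q\<close>,
  for which \<open>\<langle>q, q\<rangle> = q(0)\<close>. The constant is sharp, with equality for \<open>p = q\<close>.\<close>

lemma poly_0_sq_le_weighted_integral:
  fixes p :: "real poly"
  assumes "0 < d" "degree p \<le> l"
  shows "(poly p 0)\<^sup>2 \<le> real d * (real ((d + l) choose l))\<^sup>2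
           * integral {0..1} (\<lambda>t. t^(d-1) * (poly p t)\<^sup>2)"
proof -
  define N where "N = real d * (real ((d + l) choose l))\<^sup>2"
  have "N > 0" using \<open>0 < d\<close> by (simp add: N_def)
  obtain q where q: "degree q \<le> l" "poly q 0 = N"
    and rep: "\<And>p. degree p \<le> l \<Longrightarrow>
       ((\<lambda>t. t^(d-1) * (poly p t * poly q t)) has_integral poly p 0) {0..1}"
    using polynomial_reproducing_at_0[OF \<open>0 < d\<close>, of l] unfolding N_def by metis
  define I where "I = integral {0..1} (\<lambda>t. t^(d-1) * (poly p t)\<^sup>2)"
  \<comment> \<open>The multiple \<open>s\<close> makes \<open>s * q\<close> the orthogonal projection of \<open>p\<close> onto \<open>q\<close>; the inequality
        says that \<open>p - s * q\<close> has nonnegative square norm.\<close>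
  define s where "s = poly p 0 / N"
  have "((\<lambda>t. t^(d-1) * (poly p t)\<^sup>2) has_integral I) {0..1}"
    unfolding I_def by (intro integrable_integral integrable_continuous_real continuous_intros)
  then have "((\<lambda>t. t^(d-1) * (poly p t)\<^sup>2 - 2 * s * (t^(d-1) * (poly p t * poly q t))
         + s\<^sup>2 * (t^(d-1) * (poly q t * poly q t)))
       has_integral I - 2 * s * poly p 0 + s\<^sup>2 * N) {0..1}"
    using rep[OF assms(2)] rep[OF q(1)] unfolding q(2)
    by (intro has_integral_add has_integral_diff has_integral_mult_right)
  then have "((\<lambda>t. t^(d-1) * (poly p t - s * poly q t)\<^sup>2)
       has_integral I - 2 * s * poly p 0 + s\<^sup>2 * N) {0..1}"
    by (rule has_integral_eq[rotated]) (simp add: power2_eq_square algebra_simps)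
  then have "0 \<le> I - 2 * s * poly p 0 + s\<^sup>2 * N"
    by (rule has_integral_nonneg) auto
  also have "\<dots> = I - (poly p 0)\<^sup>2 / N"
    using \<open>N > 0\<close> by (simp add: s_def power2_eq_square field_simps)
  finally show ?thesis
    using \<open>N > 0\<close> unfolding N_def[symmetric] I_def[symmetric] by (simp add: field_simps)
qed

section \<open>Restriction of polynomials to rays\<close>

text \<open>This is where the total degree matters: a bound \<open>l\<close> on the degree in each variable separately
  would only bound the degree along a line by \<open>CARD('d) * l\<close>.\<close>

lemma polys_deg_le_restrict_line:
  fixes v :: "real ^ 'd \<Rightarrow> real"
  assumes "v \<in> polys_deg_le l"
  obtains p where "degree p \<le> l" "\<And>t. poly p t = v (x + t *\<^sub>R y)"
proof -
  obtain c :: "('d \<Rightarrow> nat) \<Rightarrow> real" where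
    v: "v = (\<lambda>x. \<Sum>a | (\<Sum>i\<in>UNIV. a i) \<le> l. c a * (\<Prod>i\<in>UNIV. (x $ i) ^ a i))"
    using assms by (auto simp: polys_deg_le_def)
  define p where "p = (\<Sum>a | (\<Sum>i\<in>UNIV. a i) \<le> l. smult (c a) (\<Prod>i\<in>UNIV. [:x $ i, y $ i:] ^ a i))"
  have "degree (smult (c a) (\<Prod>i\<in>UNIV. [:x $ i, y $ i:] ^ a i)) \<le> l"
    if "(\<Sum>i\<in>UNIV. a i) \<le> l" for a
  proof -
    have "degree (\<Prod>i\<in>UNIV. [:x $ i, y $ i:] ^ a i) \<le> (\<Sum>i\<in>UNIV. degree ([:x $ i, y $ i:] ^ a i))"
      using degree_prod_sum_le[of "UNIV :: 'd set"] by (simp add: o_def)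
    also have "\<dots> \<le> (\<Sum>i\<in>UNIV. a i)"
      by (intro sum_mono order_trans[OF degree_power_le]) simp
    finally show ?thesis using that degree_smult_le order_trans by metis
  qed
  then have "degree p \<le> l"
    unfolding p_def
    by (cases "finite {a :: 'd \<Rightarrow> nat. (\<Sum>i\<in>UNIV. a i) \<le> l}") (auto intro: degree_sum_le)
  moreover have "poly p t = v (x + t *\<^sub>R y)" for t
    by (simp add: p_def v poly_sum poly_prod)
  ultimately show thesis using that by blast
qed

lemma polys_deg_le_continuous:
  assumes "v \<in> polys_deg_le l"
  shows "continuous_on UNIV v"
  using assms by (auto simp: polys_deg_le_def intro!: continuous_intros)

text \<open>The weight \<open>t^(CARD('d) - 1)\<close> is the radial density of Lebesgue measure, which allows this bound
  to be integrated over a family of rays.\<close>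

lemma polys_deg_le_sq_le_ray_integral:
  fixes v :: "real ^ 'd \<Rightarrow> real"
  assumes "v \<in> polys_deg_le l"
  shows "ennreal ((v x)\<^sup>2) \<le> ennreal (real CARD('d) * (real ((CARD('d) + l) choose l))\<^sup>2)
     * (\<integral>\<^sup>+t. ennreal (t^(CARD('d) - 1) * (v (x + t *\<^sub>R y))\<^sup>2) * indicator {0..1} t \<partial>lborel)"
proof -
  let ?d = "CARD('d)"
  let ?N = "real ?d * (real ((?d + l) choose l))\<^sup>2"
  obtain p where p: "degree p \<le> l" "\<And>t. poly p t = v (x + t *\<^sub>R y)"
    using polys_deg_le_restrict_line[OF assms] by metis
  let ?I = "integral {0..1} (\<lambda>t. t^(?d-1) * (poly p t)\<^sup>2)"
  have I: "((\<lambda>t. t^(?d-1) * (poly p t)\<^sup>2) has_integral ?I) {0..1}"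
    by (intro integrable_integral integrable_continuous_real continuous_intros)
  then have "?I \<ge> 0" by (rule has_integral_nonneg) auto
  have "(poly p 0)\<^sup>2 \<le> ?N * ?I"
    by (rule poly_0_sq_le_weighted_integral[OF _ p(1)]) simp
  then have "ennreal ((v x)\<^sup>2) \<le> ennreal ?N * ennreal ?I"
    using \<open>?I \<ge> 0\<close> by (simp add: p ennreal_mult[symmetric] del: of_nat_mult)
  also have "ennreal ?I = (\<integral>\<^sup>+t. ennreal (t^(?d-1) * (poly p t)\<^sup>2) * indicator {0..1} t \<partial>lborel)"
    by (rule nn_integral_has_integral_lebesgue'[OF _ I, symmetric]) auto
  finally show ?thesis by (simp add: p)
qed

section \<open>Averaging over rays\<close>

lemma nn_integral_lborel_homothety:
  fixes f :: "'a::euclidean_space \<Rightarrow> ennreal"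
  assumes [measurable]: "f \<in> borel_measurable borel" and "t \<noteq> 0"
  shows "(\<integral>\<^sup>+z. f z \<partial>lborel) = ennreal (\<bar>t\<bar> ^ DIM('a)) * (\<integral>\<^sup>+y. f (x + t *\<^sub>R y) \<partial>lborel)"
proof -
  have "(\<integral>\<^sup>+z. f z \<partial>lborel)
      = (\<integral>\<^sup>+z. f z \<partial>density (distr lborel borel (\<lambda>y. x + t *\<^sub>R y)) (\<lambda>_. ennreal (\<bar>t\<bar>^DIM('a))))"
    by (subst lborel_affine[OF \<open>t \<noteq> 0\<close>, of x]) (simp add: ennreal_power)
  also have "\<dots> = (\<integral>\<^sup>+y. ennreal (\<bar>t\<bar>^DIM('a)) * f (x + t *\<^sub>R y) \<partial>lborel)"
    by (simp add: nn_integral_density nn_integral_distr)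
  also have "\<dots> = ennreal (\<bar>t\<bar> ^ DIM('a)) * (\<integral>\<^sup>+y. f (x + t *\<^sub>R y) \<partial>lborel)"
    by (rule nn_integral_cmult) measurable
  finally show ?thesis .
qed

text \<open>The integrand lives on those \<open>t\<close> with \<open>w \<in> t B\<close>, hence on
  \<open>[|w| / (3 a), |w| / a]\<close>, where \<open>1 / t\<close> is at most \<open>3 a / |w|\<close>; the product of length and height
  is 2.\<close>

lemma nn_integral_inverse_over_homotheties_le:
  fixes w :: "'a::euclidean_space"
  assumes B: "\<And>y. y \<in> B \<Longrightarrow> a \<le> norm y \<and> norm y \<le> 3 * a" and "0 < a"
  shows "(\<integral>\<^sup>+t. ennreal (1 / t) * indicator B ((1 / t) *\<^sub>R w) * indicator {0<..1} t \<partial>lborel) \<le> 2"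
proof (cases "w = 0")
  case True
  then have "0 \<notin> B" using B[of 0] \<open>0 < a\<close> by auto
  then show ?thesis using True by simp
next
  case False
  let ?w = "norm w"
  have "?w > 0" using False by simp
  have "ennreal (1 / t) * indicator B ((1 / t) *\<^sub>R w) * indicator {0<..1} t
      \<le> ennreal (3 * a / ?w) * indicator {?w / (3 * a)..?w / a} t" for t :: real
  proof (cases "(1 / t) *\<^sub>R w \<in> B \<and> 0 < t")
    case True
    then have "a \<le> ?w / t" "?w / t \<le> 3 * a" using B[of "(1 / t) *\<^sub>R w"] by auto
    then have "t \<in> {?w / (3 * a)..?w / a}" "1 / t \<le> 3 * a / ?w"
      using True \<open>0 < a\<close> \<open>?w > 0\<close> by (auto simp: field_simps)
    then show ?thesis by (auto simp: indicator_def intro!: ennreal_leI)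
  qed (auto simp: indicator_def)
  then have "(\<integral>\<^sup>+t. ennreal (1 / t) * indicator B ((1 / t) *\<^sub>R w) * indicator {0<..1} t \<partial>lborel)
      \<le> (\<integral>\<^sup>+t. ennreal (3 * a / ?w) * indicator {?w / (3 * a)..?w / a} t \<partial>lborel)"
    by (intro nn_integral_mono)
  also have "\<dots> = ennreal (3 * a / ?w) * ennreal (?w / a - ?w / (3 * a))"
    using \<open>0 < a\<close> \<open>?w > 0\<close> by (subst nn_integral_cmult_indicator) (auto simp: field_simps)
  also have "\<dots> = ennreal (3 * a / ?w * (?w / a - ?w / (3 * a)))"
    using \<open>0 < a\<close> \<open>?w > 0\<close> by (intro ennreal_mult[symmetric]) (auto simp: field_simps)
  also have "3 * a / ?w * (?w / a - ?w / (3 * a)) = 2"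
    using \<open>0 < a\<close> \<open>?w > 0\<close> by (simp add: field_simps)
  finally show ?thesis by simp
qed

text \<open>This bound takes the place of integration in polar coordinates. For fixed \<open>t\<close> the map
  \<open>y \<mapsto> x + t y\<close> turns \<open>t^(DIM('a)-1) dy\<close> into \<open>t^(-1) dz\<close>, so by Tonelli's theorem the left-hand
  side integrates \<open>F z\<close> against the \<open>dt / t\<close>-measure of the set of \<open>t\<close> for which \<open>z - x\<close> lies in
  \<open>t B\<close>. This measure is at most 2 since \<open>B\<close> lies in a spherical shell.\<close>

lemma nn_integral_rays_le:
  fixes F :: "'a::euclidean_space \<Rightarrow> ennreal"
  assumes [measurable]: "F \<in> borel_measurable borel" "B \<in> sets borel"
    and B: "\<And>y. y \<in> B \<Longrightarrow> a \<le> norm y \<and> norm y \<le> 3 * a" and "0 < a"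
  shows "(\<integral>\<^sup>+y. indicator B y *
      (\<integral>\<^sup>+t. ennreal (t^(DIM('a) - 1)) * F (x + t *\<^sub>R y) * indicator {0<..1} t \<partial>lborel) \<partial>lborel)
    \<le> 2 * (\<integral>\<^sup>+z. F z \<partial>lborel)"
proof -
  interpret lborel_pair: pair_sigma_finite "lborel :: real measure" "lborel :: 'a measure" ..
  let ?d = "DIM('a)"
  let ?i = "indicator {0<..1} :: real \<Rightarrow> ennreal"
  have "(\<integral>\<^sup>+y. indicator B y *
      (\<integral>\<^sup>+t. ennreal (t^(?d - 1)) * F (x + t *\<^sub>R y) * ?i t \<partial>lborel) \<partial>lborel)
    = (\<integral>\<^sup>+y. \<integral>\<^sup>+t. indicator B y * (ennreal (t^(?d - 1)) * F (x + t *\<^sub>R y) * ?i t) \<partial>lborel \<partial>lborel)"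
    by (intro nn_integral_cong nn_integral_cmult[symmetric]) measurable
  also have "\<dots> = (\<integral>\<^sup>+t. \<integral>\<^sup>+y. indicator B y * (ennreal (t^(?d - 1)) * F (x + t *\<^sub>R y) * ?i t) \<partial>lborel \<partial>lborel)"
    by (rule lborel_pair.Fubini') measurable
  also have "\<dots> = (\<integral>\<^sup>+t. \<integral>\<^sup>+z. F z * (ennreal (1 / t) * indicator B ((1 / t) *\<^sub>R (z - x)) * ?i t) \<partial>lborel \<partial>lborel)"
  proof (rule nn_integral_cong)
    fix t :: real
    show "(\<integral>\<^sup>+y. indicator B y * (ennreal (t^(?d - 1)) * F (x + t *\<^sub>R y) * ?i t) \<partial>lborel)
        = (\<integral>\<^sup>+z. F z * (ennreal (1 / t) * indicator B ((1 / t) *\<^sub>R (z - x)) * ?i t) \<partial>lborel)"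
    proof (cases "0 < t \<and> t \<le> 1")
      case True
      have t: "ennreal (t^(?d - Suc 0)) = ennreal (t^?d) * ennreal (1 / t)"
        using True by (subst ennreal_mult[symmetric]) (auto simp: power_diff)
      have "(\<integral>\<^sup>+z. F z * (ennreal (1 / t) * indicator B ((1 / t) *\<^sub>R (z - x)) * ?i t) \<partial>lborel)
          = ennreal (\<bar>t\<bar>^?d) * (\<integral>\<^sup>+y. F (x + t *\<^sub>R y) * (ennreal (1 / t) * indicator B y * ?i t) \<partial>lborel)"
        using True by (subst nn_integral_lborel_homothety[where x = x and t = t]) auto
      also have "\<dots> = (\<integral>\<^sup>+y. ennreal (\<bar>t\<bar>^?d) * (F (x + t *\<^sub>R y) * (ennreal (1 / t) * indicator B y * ?i t)) \<partial>lborel)"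
        by (rule nn_integral_cmult[symmetric]) measurable
      also have "\<dots> = (\<integral>\<^sup>+y. indicator B y * (ennreal (t^(?d - 1)) * F (x + t *\<^sub>R y) * ?i t) \<partial>lborel)"
        using True by (intro nn_integral_cong) (simp add: t mult_ac)
      finally show ?thesis ..
    next
      case False
      then have "?i t = 0" by (simp add: indicator_def)
      then show ?thesis by simp
    qed
  qed
  also have "\<dots> = (\<integral>\<^sup>+z. \<integral>\<^sup>+t. F z * (ennreal (1 / t) * indicator B ((1 / t) *\<^sub>R (z - x)) * ?i t) \<partial>lborel \<partial>lborel)"
    by (rule lborel_pair.Fubini'[symmetric]) measurable
  also have "\<dots> = (\<integral>\<^sup>+z. F z * (\<integral>\<^sup>+t. ennreal (1 / t) * indicator B ((1 / t) *\<^sub>R (z - x)) * ?i t \<partial>lborel) \<partial>lborel)"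
    by (intro nn_integral_cong nn_integral_cmult) measurable
  also have "\<dots> \<le> (\<integral>\<^sup>+z. F z * 2 \<partial>lborel)"
    by (intro nn_integral_mono mult_left_mono nn_integral_inverse_over_homotheties_le[OF _ \<open>0 < a\<close>] B) auto
  also have "\<dots> = 2 * (\<integral>\<^sup>+z. F z \<partial>lborel)"
    by (simp add: nn_integral_multc mult.commute)
  finally show ?thesis .
qed

section \<open>Balls inside cones\<close>

text \<open>The segments from the vertex of the cone to a ball of radius \<open>\<eta> r / 2\<close> about the point
  \<open>(r / 2) u\<close> of its axis stay in the cone. If \<open>|z| \<le> \<eta> r / 2\<close>, then \<open>y = (r / 2) u + z\<close>
  satisfies \<open>(u \<bullet> y) / |y| \<ge> (1 - \<eta>) / (1 + \<eta>)\<close>, and \<open>\<eta> = (1 - cos \<theta>) / 4\<close> keeps this quotient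
  at least \<open>cos \<theta>\<close>. It also ensures \<open>\<eta> \<le> 1 / 2\<close>, so that the ball lies in a shell whose radii
  have ratio 3. The volume of the ball depends neither on \<open>x\<close> nor on \<open>u\<close>.\<close>

lemma scaled_cball_in_trunc_cone:
  fixes u x :: "real ^ 'd"
  assumes "0 < r" "norm u = 1" "cos \<theta> < 1"
    and y: "y \<in> cball ((r / 2) *\<^sub>R u) (r / 2 * ((1 - cos \<theta>) / 4))" and t: "0 \<le> t" "t \<le> 1"
  shows "r / 4 \<le> norm y" "norm y \<le> 3 * (r / 4)" "x + t *\<^sub>R y \<in> trunc_cone r \<theta> x u"
proof -
  define \<eta> where "\<eta> = (1 - cos \<theta>) / 4"
  have \<eta>: "0 \<le> \<eta>" "\<eta> \<le> 1 / 2" and cos_eq: "cos \<theta> = 1 - 4 * \<eta>"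
    unfolding \<eta>_def using assms(3) cos_ge_minus_one[of \<theta>] by (auto simp: field_simps simp del: cos_ge_minus_one)
  define z where "z = y - (r / 2) *\<^sub>R u"
  have z: "norm z \<le> r / 2 * \<eta>" and y_eq: "y = (r / 2) *\<^sub>R u + z"
    using y by (simp_all add: z_def \<eta>_def dist_norm norm_minus_commute)
  have "r / 2 * \<eta> \<le> r / 2 * (1 / 2)"
    using \<eta> \<open>0 < r\<close> by (intro mult_left_mono) auto
  then have z4: "norm z \<le> r / 4" using z by linarith
  have ru: "norm ((r / 2) *\<^sub>R u) = r / 2" using assms by simp
  have "norm y \<ge> r / 2 - norm z"
    using norm_diff_ineq[of "(r / 2) *\<^sub>R u" z] ru unfolding y_eq by simp
  with z4 show lower: "r / 4 \<le> norm y" by simp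
  have upper: "norm y \<le> r / 2 + norm z"
    using norm_triangle_ineq[of "(r / 2) *\<^sub>R u" z] ru unfolding y_eq by simp
  with z4 show upper': "norm y \<le> 3 * (r / 4)" by simp
  have "y \<noteq> 0" "norm y > 0" using lower \<open>0 < r\<close> by auto
  have "u \<bullet> u = 1" using assms(2) by (simp add: dot_square_norm)
  have "\<bar>u \<bullet> z\<bar> \<le> norm z" using Cauchy_Schwarz_ineq2[of u z] assms(2) by simp
  then have "u \<bullet> y \<ge> r / 2 - r / 2 * \<eta>"
    using z \<open>u \<bullet> u = 1\<close> by (simp add: y_eq inner_add_right)
  \<comment> \<open>For an obtuse half-angle the upper bound on \<open>norm y\<close> cannot be multiplied by the negative
        \<open>cos \<theta>\<close>, but then the claim holds by signs alone.\<close>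
  moreover have "cos \<theta> * norm y \<le> r / 2 - r / 2 * \<eta>"
  proof (cases "cos \<theta> \<ge> 0")
    case True
    then have "cos \<theta> * norm y \<le> cos \<theta> * (r / 2 + r / 2 * \<eta>)"
      using upper z by (intro mult_left_mono) auto
    also have "\<dots> = (r / 2) * ((1 - 4 * \<eta>) * (1 + \<eta>))"
      by (simp add: cos_eq algebra_simps)
    also have "\<dots> \<le> (r / 2) * (1 - \<eta>)"
      using \<open>0 < r\<close> \<eta> by (intro mult_left_mono) (auto simp: algebra_simps)
    finally show ?thesis by (simp add: algebra_simps)
  next
    case False
    then have "cos \<theta> * norm y \<le> 0" by (simp add: mult_nonpos_nonneg)
    also have "0 \<le> r / 2 - r / 2 * \<eta>"
      using \<open>r / 2 * \<eta> \<le> r / 2 * (1 / 2)\<close> \<open>0 < r\<close> by simp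
    finally show ?thesis .
  qed
  ultimately have "cos \<theta> \<le> u \<bullet> (y /\<^sub>R norm y)"
    using \<open>norm y > 0\<close> by (simp add: field_simps)
  moreover have "t * norm y \<le> r"
    using mult_mono[OF t(2) upper'] \<open>0 < r\<close> by auto
  moreover have "norm (y /\<^sub>R norm y) = 1" "x + t *\<^sub>R y = x + (t * norm y) *\<^sub>R (y /\<^sub>R norm y)"
    using \<open>y \<noteq> 0\<close> by auto
  ultimately show "x + t *\<^sub>R y \<in> trunc_cone r \<theta> x u"
    unfolding trunc_cone_def using t(1) by (metis (mono_tags, lifting) mem_Collect_eq mult_nonneg_nonneg norm_ge_zero)
qed

section \<open>Christoffel functions and the inner cone condition\<close>

text \<open>The cones lie in the closure of \<open>D\<close> and the norm is taken over \<open>D\<close>; the two sets differ by the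
  frontier, a null set. The integral is finite since \<open>v\<close> is bounded on the compact closure, so
  passing between extended and real integrals loses nothing.\<close>

lemma nn_integral_closure_eq_L2_norm_on:
  fixes v :: "real ^ 'd \<Rightarrow> real"
  assumes D: "open D" "bounded D" "D \<noteq> {}" "negligible (frontier D)" and v: "continuous_on UNIV v"
  shows "(\<integral>\<^sup>+z. ennreal ((v z)\<^sup>2) * indicator (closure D) z \<partial>lborel)
       = ennreal (measure lebesgue D * (L2_norm_on D v)\<^sup>2)"
proof -
  have [measurable]: "v \<in> borel_measurable borel" "D \<in> sets borel"
    using v D(1) by (auto intro: borel_measurable_continuous_onI)
  let ?m = "measure lebesgue D"
  let ?I = "\<integral>\<^sup>+z. ennreal ((v z)\<^sup>2) * indicator D z \<partial>lborel"
  have m: "emeasure lborel D = ennreal ?m"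
    using emeasure_bounded_finite[OF D(2)]
    by (simp add: emeasure_eq_ennreal_measure measure_completion)
  have "?m > 0"
  proof (rule ccontr)
    assume "\<not> ?m > 0"
    then have "emeasure lebesgue D = 0"
      using m by (simp add: not_less ennreal_neg)
    then have "negligible D"
      using D(1) by (auto simp: negligible_iff_null_sets null_sets_def)
    then show False using open_not_negligible D(1,3) by blast
  qed
  obtain K where K: "\<And>z. z \<in> closure D \<Longrightarrow> (v z)\<^sup>2 \<le> K"
  proof -
    have "compact ((\<lambda>z. (v z)\<^sup>2) ` closure D)"
      using D(2) by (intro compact_continuous_image continuous_intros continuous_on_subset[OF v]) auto
    from compact_imp_bounded[OF this] show thesis
      using that by (force simp: bounded_real)
  qed
  have "?I \<le> (\<integral>\<^sup>+z. ennreal K * indicator D z \<partial>lborel)"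
    using K closure_subset[of D]
    by (intro nn_integral_mono) (auto simp: indicator_def intro!: ennreal_leI)
  also have "\<dots> < \<infinity>"
    by (simp add: nn_integral_cmult_indicator m ennreal_mult_less_top)
  finally have "?I < \<infinity>" .
  have "emeasure lborel (frontier D) = 0"
    using D(4) by (simp add: negligible_iff_null_sets null_sets_def)
  then have "AE z in lborel. z \<notin> frontier D"
    by (intro AE_not_in) (auto simp: null_sets_def)
  then have "(\<integral>\<^sup>+z. ennreal ((v z)\<^sup>2) * indicator (closure D) z \<partial>lborel) = ?I"
    using D(1) closure_subset[of D]
    by (intro nn_integral_cong_AE) (auto elim!: eventually_mono simp: indicator_def frontier_def interior_open)
  moreover have "(L2_norm_on D v)\<^sup>2 = enn2real (?I / ennreal ?m)"
  proof -
    have "(L2_norm_on D v)\<^sup>2 = (\<integral>z. (v z)\<^sup>2 \<partial>uniform_measure lborel D)"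
      by (simp add: L2_norm_on_def)
    also have "\<dots> = enn2real (\<integral>\<^sup>+z. ennreal ((v z)\<^sup>2) \<partial>uniform_measure lborel D)"
      by (rule integral_eq_nn_integral) auto
    also have "(\<integral>\<^sup>+z. ennreal ((v z)\<^sup>2) \<partial>uniform_measure lborel D) = ?I / ennreal ?m"
      by (simp add: nn_integral_uniform_measure m)
    finally show ?thesis .
  qed
  moreover have "ennreal (?m * enn2real (?I / ennreal ?m)) = ?I"
  proof -
    obtain J where "?I = ennreal J" "J \<ge> 0" using \<open>?I < \<infinity>\<close> by (cases ?I) auto
    then show ?thesis using \<open>?m > 0\<close> by (simp add: divide_ennreal)
  qed
  ultimately show ?thesis by simp
qed

text \<open>The bound along single rays is averaged over all rays from \<open>x\<close> that pass through a ball inside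
  the cone; the part of the rays that matters stays in the cone, hence in \<open>K\<close>.\<close>

lemma polys_deg_le_sq_le_integral_over_cone:
  fixes v :: "real ^ 'd \<Rightarrow> real"
  assumes v: "v \<in> polys_deg_le l" and cone: "trunc_cone r \<theta> x u \<subseteq> K" and "closed K"
    and "0 < r" "norm u = 1" "cos \<theta> < 1"
  shows "ennreal ((v x)\<^sup>2 * (unit_ball_vol CARD('d) * (r / 2 * ((1 - cos \<theta>) / 4)) ^ CARD('d)))
    \<le> ennreal (2 * real CARD('d) * (real ((CARD('d) + l) choose l))\<^sup>2)
       * (\<integral>\<^sup>+z. ennreal ((v z)\<^sup>2) * indicator K z \<partial>lborel)"
proof -
  let ?d = "CARD('d)"
  define N where "N = real ?d * (real ((?d + l) choose l))\<^sup>2"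
  define \<rho> where "\<rho> = r / 2 * ((1 - cos \<theta>) / 4)"
  define B where "B = cball ((r / 2) *\<^sub>R u) \<rho>"
  define F where "F z = ennreal ((v z)\<^sup>2) * indicator K z" for z
  have "\<rho> > 0" using assms by (simp add: \<rho>_def)
  have [measurable]: "v \<in> borel_measurable borel" "K \<in> sets borel" "B \<in> sets borel"
    using polys_deg_le_continuous[OF v] \<open>closed K\<close>
    by (auto intro: borel_measurable_continuous_onI simp: B_def)
  have [measurable]: "F \<in> borel_measurable borel"
    unfolding F_def by measurable
  note B_cone = scaled_cball_in_trunc_cone[OF \<open>0 < r\<close> \<open>norm u = 1\<close> \<open>cos \<theta> < 1\<close>, folded \<rho>_def, folded B_def]
  let ?ray = "\<lambda>y. \<integral>\<^sup>+t. ennreal (t^(?d - 1)) * F (x + t *\<^sub>R y) * indicator {0<..1} t \<partial>lborel"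
  have ray: "ennreal ((v x)\<^sup>2) \<le> ennreal N * ?ray y" if "y \<in> B" for y
  proof -
    \<comment> \<open>The intervals \<open>[0,1]\<close> and \<open>(0,1]\<close> differ only by the point 0.\<close>
    have "AE t in lborel. t \<noteq> (0::real)" by (rule AE_lborel_singleton)
    then have "(\<integral>\<^sup>+t. ennreal (t^(?d - 1) * (v (x + t *\<^sub>R y))\<^sup>2) * indicator {0..1} t \<partial>lborel) = ?ray y"
      using B_cone(3)[OF that] cone
      by (intro nn_integral_cong_AE)
         (auto elim!: eventually_mono simp: F_def indicator_def ennreal_mult subset_eq)
    then show ?thesis
      using polys_deg_le_sq_le_ray_integral[OF v, of x y] by (simp add: N_def)
  qed
  have "ennreal ((v x)\<^sup>2 * (unit_ball_vol ?d * \<rho> ^ ?d)) = ennreal ((v x)\<^sup>2) * emeasure lborel B"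
    using \<open>\<rho> > 0\<close> by (simp add: B_def emeasure_cball ennreal_mult)
  also have "\<dots> = (\<integral>\<^sup>+y. ennreal ((v x)\<^sup>2) * indicator B y \<partial>lborel)"
    by (simp add: nn_integral_cmult_indicator)
  also have "\<dots> \<le> (\<integral>\<^sup>+y. ennreal N * (indicator B y * ?ray y) \<partial>lborel)"
    using ray by (intro nn_integral_mono) (auto simp: indicator_def)
  also have "\<dots> = ennreal N * (\<integral>\<^sup>+y. indicator B y * ?ray y \<partial>lborel)"
    by (rule nn_integral_cmult) measurable
  also have "\<dots> \<le> ennreal N * (2 * (\<integral>\<^sup>+z. F z \<partial>lborel))"
    using nn_integral_rays_le[of F B "r / 4" x] B_cone(1,2)[of _ 1] \<open>0 < r\<close>
    by (intro mult_left_mono) auto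
  also have "\<dots> = ennreal (2 * N) * (\<integral>\<^sup>+z. F z \<partial>lborel)"
    by (simp add: N_def ennreal_mult mult_ac)
  finally show ?thesis by (simp add: N_def \<rho>_def F_def mult_ac)
qed

theorem theorem5p4:
  "\<exists>C :: real \<Rightarrow> real \<Rightarrow> real \<Rightarrow> real.
     \<forall>(D :: (real ^ 'd) set) r \<theta>.
       open D \<and> bounded D \<and> D \<noteq> {} \<and> negligible (frontier D) \<and> inner_cone_condition r \<theta> D \<longrightarrow>
       (\<forall>l n. n = (CARD('d) + l) choose l \<longrightarrow>
          christoffel_sup (polys_deg_le l) D
            \<le> ereal (C (measure lebesgue D) r \<theta> * (real n)\<^sup>2))"
proof -
  define \<beta> where "\<beta> r \<theta> = unit_ball_vol CARD('d) * (r / 2 * ((1 - cos \<theta>) / 4)) ^ CARD('d)" for r \<theta>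
  define C where "C m r \<theta> = 2 * real CARD('d) * m / \<beta> r \<theta>" for m r \<theta> :: real
  have "christoffel_sup (polys_deg_le l) D \<le> ereal (C (measure lebesgue D) r \<theta> * (real n)\<^sup>2)"
    if D: "open D" "bounded D" "D \<noteq> {}" "negligible (frontier D)"
      and cone: "inner_cone_condition r \<theta> D" and n: "n = (CARD('d) + l) choose l"
    for D :: "(real ^ 'd) set" and r \<theta> l n
    unfolding christoffel_sup_def christoffel_def
  proof (intro SUP_least)
    fix x :: "real ^ 'd" and v :: "real ^ 'd \<Rightarrow> real" assume "x \<in> D" and "v \<in> polys_deg_le l - {\<lambda>_. 0}"
    then have v: "v \<in> polys_deg_le l" and x: "x \<in> closure D"
      using closure_subset by auto
    have r: "0 < r" "0 < \<theta>" "\<theta> < pi"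
      using cone by (auto simp: inner_cone_condition_def)
    obtain u where u: "norm u = 1" "trunc_cone r \<theta> x u \<subseteq> closure D"
      using cone x by (auto simp: inner_cone_condition_def)
    have "cos \<theta> < 1"
      using cos_monotone_0_pi[of 0 \<theta>] r by simp
    then have "\<beta> r \<theta> > 0"
      using r by (simp add: \<beta>_def)
    let ?m = "measure lebesgue D" and ?L = "(L2_norm_on D v)\<^sup>2"
    have "ennreal ((v x)\<^sup>2 * \<beta> r \<theta>) \<le> ennreal (2 * real CARD('d) * (real n)\<^sup>2) * ennreal (?m * ?L)"
      using polys_deg_le_sq_le_integral_over_cone[OF v u(2) closed_closure r(1) u(1) \<open>cos \<theta> < 1\<close>]
        nn_integral_closure_eq_L2_norm_on[OF D polys_deg_le_continuous[OF v]]
      by (simp add: \<beta>_def n)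
    then have bound: "(v x)\<^sup>2 * \<beta> r \<theta> \<le> 2 * real CARD('d) * (real n)\<^sup>2 * (?m * ?L)"
      by (simp add: ennreal_mult[symmetric] ennreal_le_iff del: ennreal_numeral)
    \<comment> \<open>Division by a vanishing norm yields 0, which satisfies the bound.\<close>
    have "(v x)\<^sup>2 / ?L \<le> C ?m r \<theta> * (real n)\<^sup>2"
    proof (cases "?L = 0")
      case True
      then show ?thesis using \<open>\<beta> r \<theta> > 0\<close> by (simp add: C_def)
    next
      case False
      then have "?L > 0" by (simp add: zero_less_power2)
      then show ?thesis
        using bound \<open>\<beta> r \<theta> > 0\<close> by (simp add: C_def field_simps)
    qed
    then show "ereal (\<bar>v x\<bar>\<^sup>2 / ?L) \<le> ereal (C ?m r \<theta> * (real n)\<^sup>2)"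
      by simp
  qed
  then show ?thesis by blast
qed

end
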